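(* Every regular representation of a two-dimensional Bol algebra $\mathfrak{B}$ over a field $K$ of characteristic zero is, up to equivalence of matrices, given by one of the following matrices, where $u=u_1e_1+u_2e_2$, $v=v_1e_1+v_2e_2$ are vectors of $\mathfrak{B}$ and $\det(u,v)=u_1v_2-u_2v_1$: (1) $R_1(u,v)=\begin{pmatrix}0&\varepsilon_1\det(u,v)&0&0&u_2v_2\varepsilon_1&-u_2v_1\varepsilon_1\\-\varepsilon_2\det(u,v)&0&0&0&-u_1v_2\varepsilon_2&u_1v_1\varepsilon_2\end{pmatrix}$; (2) $R_2(u,v)=\begin{pmatrix}0&\varepsilon\det(u,v)&0&0&u_2v_2\varepsilon&-u_2v_1\varepsilon\\-\beta\det(u,v)&0&u_2&-u_1&-u_1v_2\beta&u_1v_1\beta\end{pmatrix}$; (3) $R_3(u,v)=\begin{pmatrix}-\det(u,v)&0&0&0&-u_1v_2&u_1v_1\\0&\det(u,v)&u_2&-u_1&u_2v_2&-u_2v_1\end{pmatrix}$.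
   Context: A (right) Bol algebra over a field $K$ is a $K$-vector space $\mathfrak{B}$ with a trilinear operation $[x;y,z]$ (also written $[x,y,z]$) and a bilinear skew-symmetric operation $x\cdot y$ (also written $[x,y]$) such that for all $x,y,z,\alpha,\beta\in\mathfrak{B}$: (i) $[x;y,y]=0$; (ii) $[x;y,z]+[z;x,y]+[y;z,x]=0$; (iii) $[[x;y,z];\alpha,\beta]=[[x;\alpha,\beta];y,z]+[x;[y;\alpha,\beta],z]+[x;y,[z;\alpha,\beta]]$; (iv) $[x\cdot y;\alpha,\beta]=[x;\alpha,\beta]\cdot y+x\cdot[y;\alpha,\beta]+[\alpha\cdot\beta;x,y]+(x\cdot y)\cdot(\alpha\cdot\beta)$. The regular representation of $\mathfrak{B}$ is the triple $(D,\delta,\Delta)$ of maps into $\mathrm{End}(\mathfrak{B})$ given by $D(u,v)(x)=[x;u,v]$, $\delta(u)(x)=x\cdot u$, $\Delta(u,v)(x)=[u;x,v]$ for $u,v,x\in\mathfrak{B}$. It is encoded by the $2\times 6$ block matrix $(D(u,v)\,|\,\delta(u)\,|\,\Delta(u,v))$, whose blocks are the matrices of these endomorphisms in a canonical basis $(e_1,e_2)$ of $\mathfrak{B}$, with the images of $e_1,e_2$ as columns. The scalars $\varepsilon_1,\varepsilon_2,\varepsilon,\beta$ are the structure constants of $\mathfrak{B}$ in the canonical basis: case (1) is $e_1\cdot e_2=0$, $[e_2,e_1,e_2]=\varepsilon_1e_1$, $[e_1,e_2,e_1]=\varepsilon_2e_2$; case (2) is $e_1\cdot e_2=e_2$, $[e_2,e_1,e_2]=\varepsilon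 e_1$, $[e_1,e_2,e_1]=\beta e_2$; case (3) is $e_1\cdot e_2=e_2$, $[e_2,e_1,e_2]=e_2$, $[e_1,e_2,e_1]=e_1$. *)

theory Defs
  imports "Jordan_Normal_Form.Matrix"
begin

text \<open>Right Bol algebras: \<open>tri x y z\<close> stands for \<open>[x; y, z]\<close> and \<open>x \<odot> y\<close> for the binary product
  \<open>x \<cdot> y\<close>.\<close>

locale bol_algebra = vector_space scale
  for scale :: "'k::field \<Rightarrow> 'b::ab_group_add \<Rightarrow> 'b" +
  fixes tri :: "'b \<Rightarrow> 'b \<Rightarrow> 'b \<Rightarrow> 'b"
    and bin :: "'b \<Rightarrow> 'b \<Rightarrow> 'b"  (infixl "\<odot>" 70)
  assumes tri_linear_1: "\<And>y z. Vector_Spaces.linear scale scale (\<lambda>x. tri x y z)"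
    and tri_linear_2: "\<And>x z. Vector_Spaces.linear scale scale (\<lambda>y. tri x y z)"
    and tri_linear_3: "\<And>x y. Vector_Spaces.linear scale scale (\<lambda>z. tri x y z)"
    and bin_linear_1: "\<And>y. Vector_Spaces.linear scale scale (\<lambda>x. x \<odot> y)"
    and bin_linear_2: "\<And>x. Vector_Spaces.linear scale scale (\<lambda>y. x \<odot> y)"
    and bin_skew: "\<And>x y. x \<odot> y = - (y \<odot> x)"
    and tri_alt: "\<And>x y. tri x y y = 0"
    and tri_cyclic: "\<And>x y z. tri x y z + tri z x y + tri y z x = 0"
    and tri_tri: "\<And>x y z a b.
      tri (tri x y z) a b = tri (tri x a b) y z + tri x (tri y a b) z + tri x y (tri z a b)"
    and tri_bin: "\<And>x y a b.
      tri (x \<odot> y) a b = tri x a b \<odot> y + x \<odot> tri y a b + tri (a \<odot> b) x y + (x \<odot> y) \<odot> (a \<odot> b)"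

text \<open>The triple \<open>(D, \<delta>, \<Delta>)\<close>.\<close>

definition regular_representation ::
  "('b \<Rightarrow> 'b \<Rightarrow> 'b \<Rightarrow> 'b) \<Rightarrow> ('b \<Rightarrow> 'b \<Rightarrow> 'b) \<Rightarrow>
    ('b \<Rightarrow> 'b \<Rightarrow> 'b \<Rightarrow> 'b) \<times> ('b \<Rightarrow> 'b \<Rightarrow> 'b) \<times> ('b \<Rightarrow> 'b \<Rightarrow> 'b \<Rightarrow> 'b)" where
  "regular_representation tri bin =
    (\<lambda>u v x. tri x u v, \<lambda>u x. bin x u, \<lambda>u v x. tri u x v)"

definition ordered_basis ::
  "('k::field \<Rightarrow> 'b::ab_group_add \<Rightarrow> 'b) \<Rightarrow> 'b list \<Rightarrow> bool" where
  "ordered_basis scale bs \<longleftrightarrow>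
    distinct bs \<and> \<not> module.dependent scale (set bs) \<and> module.span scale (set bs) = UNIV"

definition end_matrix ::
  "('k::field \<Rightarrow> 'b::ab_group_add \<Rightarrow> 'b) \<Rightarrow> 'b list \<Rightarrow> ('b \<Rightarrow> 'b) \<Rightarrow> 'k mat" where
  "end_matrix scale bs f =
    mat (length bs) (length bs)
      (\<lambda>(i, j). module.representation scale (set bs) (f (bs ! j)) (bs ! i))"

text \<open>The block matrix \<open>(D(u,v) | \<delta>(u) | \<Delta>(u,v))\<close> in a given basis.\<close>

definition rep_matrix ::
  "('k::field \<Rightarrow> 'b::ab_group_add \<Rightarrow> 'b) \<Rightarrow>
    ('b \<Rightarrow> 'b \<Rightarrow> 'b \<Rightarrow> 'b) \<times> ('b \<Rightarrow> 'b \<Rightarrow> 'b) \<times> ('b \<Rightarrow> 'b \<Rightarrow> 'b \<Rightarrow> 'b) \<Rightarrow>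
    'b list \<Rightarrow> 'b \<Rightarrow> 'b \<Rightarrow> 'k mat" where
  "rep_matrix scale \<rho> bs u v =
    (case \<rho> of (D, \<delta>, \<Delta>) \<Rightarrow>
      mat_of_cols (length bs)
        (cols (end_matrix scale bs (D u v)) @
         cols (end_matrix scale bs (\<delta> u)) @
         cols (end_matrix scale bs (\<Delta> u v))))"

text \<open>Equivalence of two families of \<open>n \<times> 3n\<close> block matrices: one invertible \<open>P\<close>, independent of
  \<open>u\<close> and \<open>v\<close>, conjugates all three blocks simultaneously.\<close>

definition rep_equivalent ::
  "nat \<Rightarrow> ('b \<Rightarrow> 'b \<Rightarrow> 'k::field mat) \<Rightarrow> ('b \<Rightarrow> 'b \<Rightarrow> 'k mat) \<Rightarrow> bool" where
  "rep_equivalent n M N \<longleftrightarrow>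
    (\<exists>P \<in> carrier_mat n n. \<exists>Q \<in> carrier_mat n n. inverts_mat P Q \<and> inverts_mat Q P \<and>
      (\<forall>u v. M u v = P * N u v * diag_block_mat [Q, Q, Q]))"

definition det2 :: "'k::field \<Rightarrow> 'k \<Rightarrow> 'k \<Rightarrow> 'k \<Rightarrow> 'k" where
  "det2 u1 u2 v1 v2 = u1 * v2 - u2 * v1"

definition R1 :: "'k::field \<Rightarrow> 'k \<Rightarrow> 'k \<Rightarrow> 'k \<Rightarrow> 'k \<Rightarrow> 'k \<Rightarrow> 'k mat" where
  "R1 \<epsilon>1 \<epsilon>2 u1 u2 v1 v2 = mat_of_rows_list 6
    [[0, \<epsilon>1 * det2 u1 u2 v1 v2, 0, 0, u2 * v2 * \<epsilon>1, - (u2 * v1 * \<epsilon>1)],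
     [- (\<epsilon>2 * det2 u1 u2 v1 v2), 0, 0, 0, - (u1 * v2 * \<epsilon>2), u1 * v1 * \<epsilon>2]]"

definition R2 :: "'k::field \<Rightarrow> 'k \<Rightarrow> 'k \<Rightarrow> 'k \<Rightarrow> 'k \<Rightarrow> 'k \<Rightarrow> 'k mat" where
  "R2 \<epsilon> \<beta> u1 u2 v1 v2 = mat_of_rows_list 6
    [[0, \<epsilon> * det2 u1 u2 v1 v2, 0, 0, u2 * v2 * \<epsilon>, - (u2 * v1 * \<epsilon>)],
     [- (\<beta> * det2 u1 u2 v1 v2), 0, u2, - u1, - (u1 * v2 * \<beta>), u1 * v1 * \<beta>]]"

definition R3 :: "'k::field \<Rightarrow> 'k \<Rightarrow> 'k \<Rightarrow> 'k \<Rightarrow> 'k mat" where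
  "R3 u1 u2 v1 v2 = mat_of_rows_list 6
    [[- det2 u1 u2 v1 v2, 0, 0, 0, - (u1 * v2), u1 * v1],
     [0, det2 u1 u2 v1 v2, u2, - u1, u2 * v2, - (u2 * v1)]]"

end

theory Submission
  imports Defs
begin

text \<open>
  In dimension two a skew bilinear map is \<open>x \<odot> y = det(x, y) w\<close> and, by (i),
  \<open>[x; y, z] = det(y, z) A x\<close> for one vector \<open>w\<close> and one endomorphism \<open>A\<close>. Axiom (iii) reduces to
  \<open>(tr A) A = 0\<close>, that is \<open>tr A = 0\<close>, and then (ii) and (iv) hold automatically. If \<open>w = 0\<close>,
  a traceless \<open>A\<close> is antidiagonal in some basis, e.g. in \<open>(e, A e)\<close> when these are independent,
  since \<open>A\<^sup>2\<close> is scalar. If \<open>w \<noteq> 0\<close>, choose a basis with \<open>e1 \<odot> e2 = e2\<close>, so that \<open>e2\<close> is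
  a multiple of \<open>w\<close>. When \<open>w\<close> is not an eigenvector of \<open>A\<close>, or \<open>A w = 0\<close>, a shift
  of \<open>e1\<close> by a multiple of \<open>w\<close> makes \<open>A\<close> antidiagonal. Otherwise \<open>e1\<close> can be chosen as
  an eigenvector for the opposite eigenvalue, and rescaling \<open>e2\<close> normalises the eigenvalues
  to \<open>-1\<close> and \<open>1\<close>.
\<close>

section \<open>Block rows of square matrices and their simultaneous conjugation\<close>

lemma mult_mat_of_cols:
  assumes "P \<in> carrier_mat m n" "set vs \<subseteq> carrier_vec n"
  shows "P * mat_of_cols n vs = mat_of_cols m (map ((*\<^sub>v) P) vs)"
  using assms by (intro eq_matI) (auto simp: mat_of_cols_index subset_iff)

lemma cols_mult:
  assumes "P \<in> carrier_mat m n" "A \<in> carrier_mat n k"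
  shows "cols (P * A) = map ((*\<^sub>v) P) (cols A)"
  using assms by (intro nth_equalityI) (auto simp: cols_def)

text \<open>Blocks standing side by side form a four-block matrix whose lower blocks have no rows.
  In this form \<open>mult_four_block_mat\<close> can multiply them by a block-diagonal
  matrix.\<close>

lemma mat_of_cols_append_four_block:
  assumes "A \<in> carrier_mat n k"
  shows "mat_of_cols n (cols A @ vs) =
    four_block_mat A (mat_of_cols n vs) (0\<^sub>m 0 k) (0\<^sub>m 0 (length vs))"
  using assms by (intro eq_matI) (auto simp: mat_of_cols_index nth_append)

lemma length_concat_cols:
  assumes "set As \<subseteq> carrier_mat n k"
  shows "length (concat (map cols As)) = length As * k"
  using assms by (induction As) auto

text \<open>Right multiplication by \<open>diag(Q, ..., Q)\<close> acts on each block separately.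
  The induction peels off the first block; the size of the diagonal matrix is proved along with it
  because block multiplication requires it.\<close>

lemma mat_of_cols_mult_diag_block:
  fixes Q :: "'a::comm_ring_1 mat"
  assumes "set As \<subseteq> carrier_mat n n" "Q \<in> carrier_mat n n"
  shows "diag_block_mat (map (\<lambda>_. Q) As) \<in> carrier_mat (length As * n) (length As * n) \<and>
    mat_of_cols n (concat (map cols As)) * diag_block_mat (map (\<lambda>_. Q) As) =
    mat_of_cols n (concat (map (\<lambda>A. cols (A * Q)) As))"
  using assms(1)
proof (induction As)
  case Nil
  then show ?case by (auto intro: eq_matI)
next
  case (Cons A As)
  let ?D = "diag_block_mat (map (\<lambda>_. Q) As)" and ?m = "length As * n"
  have A: "A \<in> carrier_mat n n" and As: "set As \<subseteq> carrier_mat n n"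
    using Cons.prems by auto
  have D: "?D \<in> carrier_mat ?m ?m"
    and IH: "mat_of_cols n (concat (map cols As)) * ?D =
      mat_of_cols n (concat (map (\<lambda>A. cols (A * Q)) As))"
    using Cons.IH[OF As] by auto
  have M: "mat_of_cols n (concat (map cols As)) \<in> carrier_mat n ?m"
    using length_concat_cols[OF As] by (metis mat_of_cols_carrier(1))
  have len: "length (concat (map (\<lambda>A. cols (A * Q)) As)) = ?m"
    using As assms(2) by (induction As) auto
  have block: "diag_block_mat (map (\<lambda>_. Q) (A # As)) =
      four_block_mat Q (0\<^sub>m n ?m) (0\<^sub>m ?m n) ?D"
    using D assms(2) by (auto simp: Let_def)
  have "mat_of_cols n (concat (map cols (A # As))) * diag_block_mat (map (\<lambda>_. Q) (A # As)) =
    four_block_mat A (mat_of_cols n (concat (map cols As))) (0\<^sub>m 0 n) (0\<^sub>m 0 ?m) *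
    four_block_mat Q (0\<^sub>m n ?m) (0\<^sub>m ?m n) ?D"
    unfolding block using A length_concat_cols[OF As]
    by (simp add: mat_of_cols_append_four_block)
  \<comment> \<open>The zero off-diagonal blocks kill the mixed terms, and the upper right product
    is the one in the induction hypothesis.\<close>
  also have "\<dots> = four_block_mat (A * Q) (mat_of_cols n (concat (map (\<lambda>A. cols (A * Q)) As)))
      (0\<^sub>m 0 n) (0\<^sub>m 0 ?m)"
    by (subst mult_four_block_mat[OF A M _ _ assms(2) _ _ D])
      (use A M D assms(2) len in \<open>auto simp: IH[symmetric]\<close>)
  also have "\<dots> = mat_of_cols n (concat (map (\<lambda>A. cols (A * Q)) (A # As)))"
    using A assms(2) len by (simp add: mat_of_cols_append_four_block[of "A * Q" n n])
  finally show ?case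
    unfolding block using assms(2) D by auto
qed

text \<open>\<open>P\<close> acts on columns and the diagonal matrix acts on blocks, so every block
  \<open>A\<close> turns into \<open>P * A * Q\<close>. With three blocks this is the shape required
  by \<open>rep_equivalent\<close>.\<close>

lemma mat_of_cols_conjugate_blocks:
  fixes P :: "'a::comm_ring_1 mat"
  assumes P: "P \<in> carrier_mat n n" and As: "set As \<subseteq> carrier_mat n n" and Q: "Q \<in> carrier_mat n n"
  shows "P * mat_of_cols n (concat (map cols As)) * diag_block_mat (map (\<lambda>_. Q) As) =
    mat_of_cols n (concat (map (\<lambda>A. cols (P * A * Q)) As))"
proof -
  have vs: "set (concat (map cols As)) \<subseteq> carrier_vec n"
    using As by (force simp: cols_def)
  have "P * mat_of_cols n (concat (map cols As)) =
      mat_of_cols n (concat (map cols (map ((*) P) As)))"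
    unfolding mult_mat_of_cols[OF P vs] map_concat
    using As P by (auto intro!: arg_cong[of _ _ "mat_of_cols n"] arg_cong[of _ _ concat]
      cols_mult[OF P, of _ n, symmetric])
  moreover have "set (map ((*) P) As) \<subseteq> carrier_mat n n"
    using As P by auto
  ultimately show ?thesis
    using mat_of_cols_mult_diag_block[of "map ((*) P) As" n Q] Q by (simp add: comp_def)
qed

section \<open>Coordinate matrices and change of basis\<close>

definition coords_mat ::
  "('k::field \<Rightarrow> 'b::ab_group_add \<Rightarrow> 'b) \<Rightarrow> 'b list \<Rightarrow> 'b list \<Rightarrow> ('b \<Rightarrow> 'b) \<Rightarrow> 'k mat" where
  "coords_mat scale bs cs f =
    mat (length cs) (length bs)
      (\<lambda>(i, j). module.representation scale (set cs) (f (bs ! j)) (cs ! i))"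

lemma coords_mat_carrier [simp]:
  "coords_mat scale bs cs f \<in> carrier_mat (length cs) (length bs)"
  by (simp add: coords_mat_def)

lemma end_matrix_eq_coords_mat: "end_matrix scale bs f = coords_mat scale bs bs f"
  by (simp add: end_matrix_def coords_mat_def)

context vector_space
begin

lemma ordered_basis_expand:
  assumes "ordered_basis scale bs"
  shows "(\<Sum>i<length bs. representation (set bs) v (bs ! i) *s bs ! i) = v"
proof -
  have "bij_betw ((!) bs) {..<length bs} (set bs)"
    using assms by (intro bij_betw_nth) (auto simp: ordered_basis_def)
  then have "(\<Sum>i<length bs. representation (set bs) v (bs ! i) *s bs ! i) =
      (\<Sum>b\<in>set bs. representation (set bs) v b *s b)"
    by (rule sum.reindex_bij_betw)
  also have "\<dots> = v"
    using assms by (intro sum_representation_eq) (auto simp: ordered_basis_def)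
  finally show ?thesis .
qed

text \<open>Expand \<open>f (bs ! j)\<close> in the basis \<open>cs\<close>, apply the linear map
  \<open>g\<close>, and read off coordinates with respect to \<open>ds\<close>: this is the matrix
  product.\<close>

lemma coords_mat_comp:
  assumes cs: "ordered_basis scale cs" and ds: "ordered_basis scale ds"
    and g: "Vector_Spaces.linear scale scale g"
  shows "coords_mat scale bs ds (g \<circ> f) = coords_mat scale cs ds g * coords_mat scale bs cs f"
proof (rule eq_matI)
  fix i j
  assume "i < dim_row (coords_mat scale cs ds g * coords_mat scale bs cs f)"
    and "j < dim_col (coords_mat scale cs ds g * coords_mat scale bs cs f)"
  then have ij: "i < length ds" "j < length bs" by (auto simp: coords_mat_def)
  interpret g: Vector_Spaces.linear scale scale g by (rule g)
  have ind: "independent (set ds)" and span: "\<And>v. v \<in> span (set ds)"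
    using ds by (auto simp: ordered_basis_def)
  let ?c = "\<lambda>k. representation (set cs) (f (bs ! j)) (cs ! k)"
  have "g (f (bs ! j)) = (\<Sum>k<length cs. ?c k *s g (cs ! k))"
    by (subst ordered_basis_expand[OF cs, of "f (bs ! j)", symmetric])
      (simp only: g.sum g.scale)
  then have "representation (set ds) (g (f (bs ! j))) (ds ! i) =
      (\<Sum>k<length cs. ?c k * representation (set ds) (g (cs ! k)) (ds ! i))"
    by (simp add: representation_sum[OF ind span] representation_scale[OF ind span])
  then show "coords_mat scale bs ds (g \<circ> f) $$ (i, j) =
      (coords_mat scale cs ds g * coords_mat scale bs cs f) $$ (i, j)"
    using ij by (simp add: coords_mat_def scalar_prod_def atLeast0LessThan mult.commute)
qed (auto simp: coords_mat_def)

lemma coords_mat_id: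
  assumes "ordered_basis scale bs"
  shows "coords_mat scale bs bs id = 1\<^sub>m (length bs)"
  using assms
  by (intro eq_matI) (auto simp: coords_mat_def ordered_basis_def representation_basis
    nth_eq_iff_index_eq)

lemma linear_id: "Vector_Spaces.linear scale scale id"
  by (simp add: Vector_Spaces.linear_iff vector_space_axioms)

text \<open>The matrix of \<open>f\<close> from \<open>bs\<close> to \<open>cs\<close> factors out
  of both \<open>f \<circ> id\<close> and \<open>id \<circ> f\<close>. The transition matrices are
  thus the coordinate matrices of the identity.\<close>

lemma end_matrix_change_basis:
  assumes bs: "ordered_basis scale bs" and cs: "ordered_basis scale cs"
    and f: "Vector_Spaces.linear scale scale f"
  shows "end_matrix scale cs f =
    coords_mat scale bs cs id * end_matrix scale bs f * coords_mat scale cs bs id"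
  unfolding end_matrix_eq_coords_mat
  using coords_mat_comp[OF bs cs f, of cs id] coords_mat_comp[OF bs cs linear_id, of bs f]
  by simp

lemma coords_mat_inverts:
  assumes "ordered_basis scale bs" "ordered_basis scale cs"
  shows "inverts_mat (coords_mat scale bs cs id) (coords_mat scale cs bs id)"
  using coords_mat_comp[OF assms linear_id, of cs id] coords_mat_id[OF assms(2)]
  by (simp add: inverts_mat_def coords_mat_def)

lemma length_ordered_basis:
  assumes "ordered_basis scale bs"
  shows "length bs = dim UNIV"
  using assms dim_eq_card[of "set bs" UNIV] distinct_card[of bs]
  by (simp add: ordered_basis_def)

text \<open>The transition matrices depend only on the two bases and not on \<open>u\<close> and
  \<open>v\<close>, so a single pair \<open>P\<close>, \<open>Q\<close> conjugates all three blocks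
  for all arguments.\<close>

lemma rep_equivalent_ordered_bases:
  assumes bs: "ordered_basis scale bs" and cs: "ordered_basis scale cs"
    and lin: "\<And>u v. Vector_Spaces.linear scale scale (D u v)"
      "\<And>u. Vector_Spaces.linear scale scale (\<delta> u)"
      "\<And>u v. Vector_Spaces.linear scale scale (\<Delta> u v)"
  shows "rep_equivalent (dim UNIV) (rep_matrix scale (D, \<delta>, \<Delta>) cs) (rep_matrix scale (D, \<delta>, \<Delta>) bs)"
proof -
  let ?P = "coords_mat scale bs cs id" and ?Q = "coords_mat scale cs bs id"
  let ?n = "dim UNIV"
  have len: "length bs = ?n" "length cs = ?n"
    using bs cs length_ordered_basis by auto
  have PQ: "?P \<in> carrier_mat ?n ?n" "?Q \<in> carrier_mat ?n ?n"
    using coords_mat_carrier[of scale bs cs id] coords_mat_carrier[of scale cs bs id] len by auto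
  have E: "end_matrix scale bs f \<in> carrier_mat ?n ?n" for f
    by (simp add: end_matrix_def len)
  have "rep_matrix scale (D, \<delta>, \<Delta>) cs u v =
      ?P * rep_matrix scale (D, \<delta>, \<Delta>) bs u v * diag_block_mat [?Q, ?Q, ?Q]" for u v
    using mat_of_cols_conjugate_blocks[OF PQ(1) _ PQ(2),
        of "[end_matrix scale bs (D u v), end_matrix scale bs (\<delta> u), end_matrix scale bs (\<Delta> u v)]"] E
    by (simp add: rep_matrix_def len end_matrix_change_basis[OF bs cs] lin)
  then show ?thesis
    unfolding rep_equivalent_def using PQ coords_mat_inverts bs cs by blast
qed

section \<open>Ordered bases of a plane\<close>

lemma comb_in_span_pair: "x *s a + y *s b \<in> span {a, b}"
  by (intro span_add span_scale span_base) auto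

lemma ordered_basis_pair_iff:
  assumes "dim (UNIV :: 'b set) = 2"
  shows "ordered_basis scale [a, b] \<longleftrightarrow> (\<forall>v. \<exists>x y. v = x *s a + y *s b)"
proof
  assume "ordered_basis scale [a, b]"
  from ordered_basis_expand[OF this] show "\<forall>v. \<exists>x y. v = x *s a + y *s b"
    by (simp add: lessThan_Suc numeral_2_eq_2) (metis add.commute)
next
  assume "\<forall>v. \<exists>x y. v = x *s a + y *s b"
  then have span: "span {a, b} = UNIV"
    using comb_in_span_pair by (metis UNIV_eq_I)
  \<comment> \<open>A maximal independent subset of \<open>{a, b}\<close> still spans, so it has two
    elements. It is therefore all of \<open>{a, b}\<close>, and \<open>a\<close> and
    \<open>b\<close> differ.\<close>
  obtain B where B: "B \<subseteq> {a, b}" "independent B" "{a, b} \<subseteq> span B"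
    using maximal_independent_subset by blast
  have "span B = UNIV"
    using B span by (metis span_eq span_superset subset_trans)
  then have "card B = 2"
    using dim_eq_card[of B UNIV] B assms by simp
  moreover have "card {a, b} \<le> 2"
    by (simp add: card_insert_if)
  ultimately have "B = {a, b}" "a \<noteq> b"
    using B(1) card_seteq[of "{a, b}" B] by (auto simp: card_insert_if)
  then show "ordered_basis scale [a, b]"
    using B span by (simp add: ordered_basis_def)
qed

lemma ordered_basis_pair_exists:
  assumes "dim (UNIV :: 'b set) = 2"
  obtains a b where "ordered_basis scale [a, b]"
proof -
  obtain B where B: "independent B" "UNIV \<subseteq> span B" "card B = 2"
    using basis_exists[of UNIV] assms by metis
  then obtain a b where "B = {a, b}" "a \<noteq> b"
    by (auto simp: card_2_iff)
  with B that show thesis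
    by (auto simp: ordered_basis_def)
qed

text \<open>Cramer's rule gives the coordinates of an arbitrary vector in the new pair, which
  therefore spans.\<close>

lemma ordered_basis_pair_transform:
  assumes dim2: "dim (UNIV :: 'b set) = 2" and ab: "ordered_basis scale [a, b]"
    and det: "p * s - q * r \<noteq> 0"
  shows "ordered_basis scale [p *s a + q *s b, r *s a + s *s b]"
  unfolding ordered_basis_pair_iff[OF dim2]
proof
  fix v
  obtain x y where v: "v = x *s a + y *s b"
    using ab ordered_basis_pair_iff[OF dim2] by blast
  define d where "d = p * s - q * r"
  have "x * d = (x * s - y * r) * p + (y * p - x * q) * r"
    "y * d = (x * s - y * r) * q + (y * p - x * q) * s"
    by (simp_all add: d_def algebra_simps)
  moreover have "d \<noteq> 0"
    using det by (simp add: d_def)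
  ultimately have "x = ((x * s - y * r) / d) * p + ((y * p - x * q) / d) * r"
    "y = ((x * s - y * r) / d) * q + ((y * p - x * q) / d) * s"
    by (simp_all add: add_divide_distrib[symmetric] nonzero_eq_divide_eq)
  moreover have "c1 *s (p *s a + q *s b) + c2 *s (r *s a + s *s b) =
      (c1 * p + c2 * r) *s a + (c1 * q + c2 * s) *s b" for c1 c2
    by (simp add: scale_right_distrib scale_left_distrib add_ac)
  ultimately show "\<exists>x y. v = x *s (p *s a + q *s b) + y *s (r *s a + s *s b)"
    unfolding v by metis
qed

lemma representation_pair:
  assumes "ordered_basis scale [a, b]"
  shows "representation {a, b} (x *s a + y *s b) a = x"
    and "representation {a, b} (x *s a + y *s b) b = y"
proof -
  have ind: "independent {a, b}" "a \<noteq> b" and sp: "\<And>v. v \<in> span {a, b}"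
    using assms by (auto simp: ordered_basis_def)
  show "representation {a, b} (x *s a + y *s b) a = x"
    and "representation {a, b} (x *s a + y *s b) b = y"
    using ind(2)
    by (simp_all add: representation_add[OF ind(1) sp sp] representation_scale[OF ind(1) sp]
      representation_basis[OF ind(1)])
qed

end

section \<open>Coordinate formulas for the two operations over a field of characteristic
  zero\<close>

locale bol_algebra_char_0 = bol_algebra scale tri bin
  for scale :: "'k::field_char_0 \<Rightarrow> 'b::ab_group_add \<Rightarrow> 'b" (infixr "*s" 75)
    and tri :: "'b \<Rightarrow> 'b \<Rightarrow> 'b \<Rightarrow> 'b"
    and bin :: "'b \<Rightarrow> 'b \<Rightarrow> 'b"
begin

lemmas tri_add =
  tri_linear_1[unfolded Vector_Spaces.linear_iff, THEN conjunct2, THEN conjunct2, THEN conjunct1, rule_format]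
  tri_linear_2[unfolded Vector_Spaces.linear_iff, THEN conjunct2, THEN conjunct2, THEN conjunct1, rule_format]
  tri_linear_3[unfolded Vector_Spaces.linear_iff, THEN conjunct2, THEN conjunct2, THEN conjunct1, rule_format]

lemmas tri_scale =
  tri_linear_1[unfolded Vector_Spaces.linear_iff, THEN conjunct2, THEN conjunct2, THEN conjunct2, rule_format]
  tri_linear_2[unfolded Vector_Spaces.linear_iff, THEN conjunct2, THEN conjunct2, THEN conjunct2, rule_format]
  tri_linear_3[unfolded Vector_Spaces.linear_iff, THEN conjunct2, THEN conjunct2, THEN conjunct2, rule_format]

lemmas bin_add =
  bin_linear_1[unfolded Vector_Spaces.linear_iff, THEN conjunct2, THEN conjunct2, THEN conjunct1, rule_format]
  bin_linear_2[unfolded Vector_Spaces.linear_iff, THEN conjunct2, THEN conjunct2, THEN conjunct1, rule_format]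

lemmas bin_scale =
  bin_linear_1[unfolded Vector_Spaces.linear_iff, THEN conjunct2, THEN conjunct2, THEN conjunct2, rule_format]
  bin_linear_2[unfolded Vector_Spaces.linear_iff, THEN conjunct2, THEN conjunct2, THEN conjunct2, rule_format]

lemma tri_swap: "tri x y z = - tri x z y"
proof -
  have "tri x (y + z) (y + z) = 0"
    by (rule tri_alt)
  then have "tri x y z + tri x z y = 0"
    unfolding tri_add by (simp add: tri_alt add.commute)
  then show ?thesis
    by (simp add: eq_neg_iff_add_eq_0)
qed

lemma bin_self [simp]: "bin x x = 0"
proof -
  \<comment> \<open>Skew symmetry only yields \<open>2 (x \<cdot> x) = 0\<close>; the factor 2 is
    cancelled in characteristic zero.\<close>
  have "(1 + 1) *s bin x x = 0"
    using bin_skew[of x x] unfolding scale_left_distrib by (simp add: eq_neg_iff_add_eq_0)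
  then show ?thesis
    by simp
qed

text \<open>The ternary operation alternates in its last two arguments, so these contribute only
  their determinant. What remains is the endomorphism \<open>A x = tri x a b\<close> applied to the
  first argument.\<close>

lemma tri_comb:
  "tri (x1 *s a + x2 *s b) (y1 *s a + y2 *s b) (z1 *s a + z2 *s b) =
    (y1 * z2 - y2 * z1) *s (x1 *s tri a a b + x2 *s tri b a b)"
proof -
  have "tri x (y1 *s a + y2 *s b) (z1 *s a + z2 *s b) = (y1 * z2 - y2 * z1) *s tri x a b" for x
    using tri_swap[of x b a]
    by (simp add: tri_add tri_scale tri_alt scale_left_diff_distrib mult.commute)
  then show ?thesis
    by (simp only: tri_add(1) tri_scale(1))
qed

lemma bin_comb:
  "bin (x1 *s a + x2 *s b) (y1 *s a + y2 *s b) = (x1 * y2 - x2 * y1) *s bin a b"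
  using bin_skew[of b a]
  by (simp add: bin_add bin_scale scale_left_diff_distrib mult.commute)

lemma tri_coords:
  assumes "tri a a b = p *s a + q *s b" "tri b a b = r *s a + s *s b"
  shows "tri (x1 *s a + x2 *s b) (y1 *s a + y2 *s b) (z1 *s a + z2 *s b) =
    ((y1 * z2 - y2 * z1) * (x1 * p + x2 * r)) *s a + ((y1 * z2 - y2 * z1) * (x1 * q + x2 * s)) *s b"
  unfolding tri_comb assms by (simp add: scale_right_distrib scale_left_distrib distrib_left)

text \<open>This covers all three normal forms at once. Here \<open>(p, q)\<close> and
  \<open>(r, s)\<close> are the columns of \<open>A x = tri x a b\<close>, and \<open>(l, m)\<close>
  are the coordinates of \<open>a \<cdot> b\<close>. The factors \<open>v2\<close> and
  \<open>- v1\<close> in the last block are \<open>det(a, v)\<close> and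
  \<open>det(b, v)\<close>.\<close>

lemma rep_matrix_coords:
  assumes basis: "ordered_basis scale [a, b]"
    and tri: "tri a a b = p *s a + q *s b" "tri b a b = r *s a + s *s b"
    and bin: "bin a b = l *s a + m *s b"
  shows "rep_matrix scale (regular_representation tri bin) [a, b] (u1 *s a + u2 *s b) (v1 *s a + v2 *s b) =
    mat_of_rows_list 6
      [[det2 u1 u2 v1 v2 * p, det2 u1 u2 v1 v2 * r, u2 * l, - (u1 * l),
        v2 * (u1 * p + u2 * r), - (v1 * (u1 * p + u2 * r))],
       [det2 u1 u2 v1 v2 * q, det2 u1 u2 v1 v2 * s, u2 * m, - (u1 * m),
        v2 * (u1 * q + u2 * s), - (v1 * (u1 * q + u2 * s))]]"
proof -
  let ?u = "u1 *s a + u2 *s b" and ?v = "v1 *s a + v2 *s b" and ?d = "det2 u1 u2 v1 v2"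
  note T = tri_coords[OF tri]
  have D: "tri a ?u ?v = (?d * p) *s a + (?d * q) *s b" "tri b ?u ?v = (?d * r) *s a + (?d * s) *s b"
    using T[of 1 0 u1 u2 v1 v2] T[of 0 1 u1 u2 v1 v2] by (simp_all add: det2_def)
  have \<delta>: "bin a ?u = (u2 * l) *s a + (u2 * m) *s b"
    "bin b ?u = (- (u1 * l)) *s a + (- (u1 * m)) *s b"
    using bin_comb[of 1 a 0 b u1 u2] bin_comb[of 0 a 1 b u1 u2]
    by (simp_all add: bin scale_right_distrib)
  have \<Delta>: "tri ?u a ?v = (v2 * (u1 * p + u2 * r)) *s a + (v2 * (u1 * q + u2 * s)) *s b"
    "tri ?u b ?v = (- (v1 * (u1 * p + u2 * r))) *s a + (- (v1 * (u1 * q + u2 * s))) *s b"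
    using T[of u1 u2 1 0 v1 v2] T[of u1 u2 0 1 v1 v2] by simp_all
  have cols: "cols A = [col A 0, col A 1]" if "A \<in> carrier_mat 2 2" for A :: "'k mat"
    using that by (simp add: cols_def numeral_2_eq_2)
  have end_cols: "cols (end_matrix scale [a, b] f) = [vec_of_list [c1, c2], vec_of_list [d1, d2]]"
    if "f a = c1 *s a + c2 *s b" "f b = d1 *s a + d2 *s b" for f c1 c2 d1 d2
  proof -
    have carrier: "end_matrix scale [a, b] f \<in> carrier_mat 2 2"
      by (intro carrier_matI) (simp_all add: end_matrix_def)
    show ?thesis
      unfolding cols[OF carrier]
      by (auto simp: end_matrix_def that representation_pair[OF basis] less_Suc_eq
          intro!: eq_vecI)
  qed
  show ?thesis
    unfolding rep_matrix_def regular_representation_def prod.case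
      end_cols[of "\<lambda>x. tri x ?u ?v", OF D] end_cols[of "\<lambda>x. bin x ?u", OF \<delta>]
      end_cols[of "\<lambda>x. tri ?u x ?v", OF \<Delta>]
    by (intro eq_matI)
      (auto simp: mat_of_cols_index mat_of_rows_list_def less_Suc_eq numeral_eq_Suc)
qed

lemma structure_constants:
  assumes dim2: "dim (UNIV :: 'b set) = 2" and basis: "ordered_basis scale [a, b]"
  obtains p q r l m where "tri a a b = p *s a + q *s b" "tri b a b = r *s a + (- p) *s b"
    "bin a b = l *s a + m *s b"
proof -
  note ex = basis[unfolded ordered_basis_pair_iff[OF dim2], rule_format]
  obtain p q where A: "tri a a b = p *s a + q *s b" using ex by blast
  obtain r s where B: "tri b a b = r *s a + s *s b" using ex by blast
  obtain l m where C: "bin a b = l *s a + m *s b" using ex by blast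
  \<comment> \<open>Take both pairs in axiom (iii) equal to \<open>(a, b)\<close>. The terms
    \<open>A (A x)\<close> cancel, and the other two add up to the trace of \<open>A\<close> times
    \<open>A x\<close>.\<close>
  have trace: "(p + s) *s tri x a b = 0" for x
  proof -
    have "tri x (tri a a b) b + tri x a (tri b a b) = 0"
      using tri_tri[of x a b a b] by simp
    then show ?thesis
      by (simp add: A B tri_add tri_scale tri_alt scale_left_distrib)
  qed
  have "s = - p"
  proof (cases "p + s = 0")
    case True
    then show ?thesis by (simp add: eq_neg_iff_add_eq_0 add.commute)
  next
    case False
    \<comment> \<open>A nonzero trace forces \<open>A = 0\<close>, whose trace vanishes as
      well.\<close>
    then have "tri a a b = 0" "tri b a b = 0"
      using trace by simp_all
    then have "p = 0" "s = 0"
      using A B representation_pair[OF basis, of p q] representation_pair[OF basis, of r s]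
        representation_pair[OF basis, of 0 0] by auto
    then show ?thesis by simp
  qed
  with A B C that show thesis by blast
qed

section \<open>Choice of a canonical basis\<close>

lemma pair_cong: "x = x' \<Longrightarrow> y = y' \<Longrightarrow> x *s a + y *s b = x' *s a + y' *s b"
  by simp

text \<open>A traceless \<open>A\<close> satisfies \<open>A (A x) = (p * p + q * r) x\<close>. Hence
  a pair \<open>(e, A e)\<close> that is a basis makes \<open>A\<close> antidiagonal; if neither
  basis vector supplies such an \<open>e\<close>, then \<open>A\<close> is already diagonal.\<close>

lemma antidiagonal_basis:
  assumes dim2: "dim (UNIV :: 'b set) = 2"
  obtains e1 e2 \<epsilon>1 \<epsilon>2 where "ordered_basis scale [e1, e2]"
    "tri e2 e1 e2 = \<epsilon>1 *s e1" "tri e1 e2 e1 = \<epsilon>2 *s e2"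
proof -
  obtain a b where basis: "ordered_basis scale [a, b]"
    using ordered_basis_pair_exists[OF dim2] .
  obtain p q r where "tri a a b = p *s a + q *s b" "tri b a b = r *s a + (- p) *s b"
    using structure_constants[OF dim2 basis] by metis
  note T = tri_coords[OF this]
  note result = that
  have suff: thesis if "x1 * y2 - x2 * y1 \<noteq> 0"
    "(x1 * y2 - x2 * y1) * (y1 * p + y2 * r) = c * x1"
    "(x1 * y2 - x2 * y1) * (y1 * q - y2 * p) = c * x2"
    "(y1 * x2 - y2 * x1) * (x1 * p + x2 * r) = d * y1"
    "(y1 * x2 - y2 * x1) * (x1 * q - x2 * p) = d * y2" for x1 x2 y1 y2 c d
    using that(1)
    by (intro result[of "x1 *s a + x2 *s b" "y1 *s a + y2 *s b" c d]
        ordered_basis_pair_transform[OF dim2 basis])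
      (simp_all add: T that scale_right_distrib)
  consider "q \<noteq> 0" | "q = 0" "r \<noteq> 0" | "q = 0" "r = 0" by blast
  then show thesis
  proof cases
    case 1
    then show ?thesis
      \<comment> \<open>The instantiation follows the order of occurrence \<open>x1\<close>,
        \<open>y2\<close>, \<open>x2\<close>, \<open>y1\<close>, \<open>c\<close>, \<open>d\<close>,
        so the new basis is \<open>(a, A a)\<close>.\<close>
      by (intro suff[of 1 q 0 p "q * (p * p + q * r)" "- q"]) (auto simp: algebra_simps)
  next
    case 2
    then show ?thesis
      \<comment> \<open>Here the basis is \<open>(b, A b)\<close>.\<close>
      by (intro suff[of 0 "- p" 1 r "- r * (p * p + q * r)" r]) (auto simp: algebra_simps)
  next
    case 3
    then show ?thesis
      \<comment> \<open>Now \<open>A\<close> is diagonal with entries \<open>p\<close> and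
        \<open>- p\<close>, so it maps \<open>a + b\<close> and \<open>a - b\<close> to multiples of
        each other.\<close>
      by (intro suff[of 1 "- 1" 1 1 "- 2 * p" "2 * p"]) (auto simp: algebra_simps)
  qed
qed

text \<open>Let \<open>w\<close> be the product of any two basis vectors. Choosing \<open>w\<close>
  as second vector and a first vector with \<open>det(e1, w) = 1\<close> gives
  \<open>e1 \<cdot> w = w\<close>. The two cases take \<open>e1\<close> along \<open>a\<close> or
  along \<open>b\<close>.\<close>

lemma basis_bin_eq_snd:
  assumes dim2: "dim (UNIV :: 'b set) = 2" and nz: "bin x y \<noteq> 0"
  obtains a b where "ordered_basis scale [a, b]" "bin a b = b"
proof -
  obtain a b where basis: "ordered_basis scale [a, b]"
    using ordered_basis_pair_exists[OF dim2] .
  obtain l m where w: "bin a b = l *s a + m *s b"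
    using structure_constants[OF dim2 basis] by metis
  obtain x1 x2 y1 y2 where "x = x1 *s a + x2 *s b" "y = y1 *s a + y2 *s b"
    using basis[unfolded ordered_basis_pair_iff[OF dim2]] by metis
  then have "bin a b \<noteq> 0"
    using nz by (auto simp: bin_comb)
  then consider "m \<noteq> 0" | "m = 0" "l \<noteq> 0"
    using w by fastforce
  then show thesis
  proof cases
    case 1
    then have "ordered_basis scale [(1 / m) *s a + 0 *s b, l *s a + m *s b]"
      by (intro ordered_basis_pair_transform[OF dim2 basis]) simp
    moreover have "bin ((1 / m) *s a + 0 *s b) (l *s a + m *s b) = l *s a + m *s b"
      unfolding bin_comb w using 1 by simp
    ultimately show ?thesis
      by (rule that)
  next
    case 2
    then have "ordered_basis scale [0 *s a + (- 1 / l) *s b, l *s a + m *s b]"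
      by (intro ordered_basis_pair_transform[OF dim2 basis]) simp
    moreover have "bin (0 *s a + (- 1 / l) *s b) (l *s a + m *s b) = l *s a + m *s b"
      unfolding bin_comb w using 2 by simp
    ultimately show ?thesis
      by (rule that)
  qed
qed

lemma canonical_basis:
  assumes dim2: "dim (UNIV :: 'b set) = 2"
  obtains e1 e2 where "ordered_basis scale [e1, e2]"
    "(\<exists>\<epsilon>1 \<epsilon>2. bin e1 e2 = 0 \<and> tri e2 e1 e2 = \<epsilon>1 *s e1 \<and> tri e1 e2 e1 = \<epsilon>2 *s e2) \<or>
     (\<exists>\<epsilon> \<beta>. bin e1 e2 = e2 \<and> tri e2 e1 e2 = \<epsilon> *s e1 \<and> tri e1 e2 e1 = \<beta> *s e2) \<or>
     (bin e1 e2 = e2 \<and> tri e2 e1 e2 = e2 \<and> tri e1 e2 e1 = e1)"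
proof (cases "\<forall>x y. bin x y = 0")
  case True
  obtain e1 e2 \<epsilon>1 \<epsilon>2 where "ordered_basis scale [e1, e2]"
    "tri e2 e1 e2 = \<epsilon>1 *s e1" "tri e1 e2 e1 = \<epsilon>2 *s e2"
    using antidiagonal_basis[OF dim2] .
  with True show thesis
    by (intro that) blast+
next
  case False
  then obtain a b where basis: "ordered_basis scale [a, b]" and ab: "bin a b = b"
    using basis_bin_eq_snd[OF dim2] by metis
  obtain p q r where "tri a a b = p *s a + q *s b" "tri b a b = r *s a + (- p) *s b"
    using structure_constants[OF dim2 basis] by metis
  note T = tri_coords[OF this]
  \<comment> \<open>These substitutions, with determinant \<open>c\<close>, preserve the relation
    \<open>e1 \<cdot> e2 = e2\<close>; \<open>t\<close> and \<open>c\<close> remain free to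
    normalise \<open>A\<close>.\<close>
  have new_basis: "ordered_basis scale [1 *s a + t *s b, 0 *s a + c *s b]"
    and bin_new: "bin (1 *s a + t *s b) (0 *s a + c *s b) = 0 *s a + c *s b" if "c \<noteq> 0" for t c
    using ordered_basis_pair_transform[OF dim2 basis, of 1 c t 0] that
      bin_comb[of 1 a t b 0 c] ab by simp_all
  consider "r \<noteq> 0" | "r = 0" "p = 0" | "r = 0" "p \<noteq> 0" by blast
  then show thesis
  proof cases
    case 1
    \<comment> \<open>This shift makes \<open>A b\<close> equal to \<open>r\<close> times the new
      \<open>e1\<close>; since the trace is zero, \<open>A e1\<close> is then a multiple of
      \<open>b\<close>.\<close>
    let ?e1 = "1 *s a + (- (p / r)) *s b" and ?e2 = "0 *s a + 1 *s b"
    have "tri ?e2 ?e1 ?e2 = r *s ?e1" "tri ?e1 ?e2 ?e1 = (- (p * p / r) - q) *s ?e2"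
      unfolding T scale_right_distrib scale_scale using 1 by (auto intro!: pair_cong simp: field_simps)
    moreover have "bin ?e1 ?e2 = ?e2"
      by (rule bin_new) simp
    moreover have "ordered_basis scale [?e1, ?e2]"
      by (rule new_basis) simp
    ultimately show ?thesis
      by (intro that) blast+
  next
    case 2
    let ?e1 = "1 *s a + 0 *s b" and ?e2 = "0 *s a + 1 *s b"
    have "tri ?e2 ?e1 ?e2 = 0 *s ?e1" "tri ?e1 ?e2 ?e1 = (- q) *s ?e2"
      unfolding T using 2 by simp_all
    moreover have "bin ?e1 ?e2 = ?e2"
      by (rule bin_new) simp
    moreover have "ordered_basis scale [?e1, ?e2]"
      by (rule new_basis) simp
    ultimately show ?thesis
      by (intro that) blast+
  next
    case 3
    \<comment> \<open>Here \<open>b\<close> has eigenvalue \<open>- p\<close>, and the shift makes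
      \<open>e1\<close> an eigenvector for \<open>p\<close>. Since \<open>det(e1, e2)\<close> is the
      scale factor of \<open>e2\<close>, taking it to be \<open>- 1 / p\<close> gives both brackets
      coefficient one.\<close>
    let ?e1 = "1 *s a + (q / (2 * p)) *s b" and ?e2 = "0 *s a + (- 1 / p) *s b"
    have "tri ?e2 ?e1 ?e2 = ?e2"
      unfolding T using 3 by (intro pair_cong) (simp_all add: field_simps)
    moreover have "tri ?e1 ?e2 ?e1 = ?e1"
      unfolding T using 3 by (intro pair_cong) (simp_all add: field_simps)
    moreover have "bin ?e1 ?e2 = ?e2"
      by (rule bin_new) (use 3 in simp)
    moreover have "ordered_basis scale [?e1, ?e2]"
      by (rule new_basis) (use 3 in simp)
    ultimately show ?thesis
      by (intro that) blast+
  qed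
qed

section \<open>The three normal forms and the classification\<close>

lemma rep_matrix_R1:
  assumes "ordered_basis scale [e1, e2]" "bin e1 e2 = 0"
    "tri e2 e1 e2 = \<epsilon>1 *s e1" "tri e1 e2 e1 = \<epsilon>2 *s e2"
  shows "rep_matrix scale (regular_representation tri bin) [e1, e2]
      (u1 *s e1 + u2 *s e2) (v1 *s e1 + v2 *s e2) = R1 \<epsilon>1 \<epsilon>2 u1 u2 v1 v2"
  \<comment> \<open>The general formula uses \<open>tri e1 e1 e2\<close>, the canonical constants
    use \<open>tri e1 e2 e1\<close>; \<open>tri_swap\<close> accounts for the sign of the first
    column of \<open>A\<close>.\<close>
  using rep_matrix_coords[OF assms(1), of 0 "- \<epsilon>2" \<epsilon>1 0 0 0 u1 u2 v1 v2] assms(2-)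
    tri_swap[of e1 e1 e2]
  by (simp add: R1_def mult_ac)

lemma rep_matrix_R2:
  assumes "ordered_basis scale [e1, e2]" "bin e1 e2 = e2"
    "tri e2 e1 e2 = \<epsilon> *s e1" "tri e1 e2 e1 = \<beta> *s e2"
  shows "rep_matrix scale (regular_representation tri bin) [e1, e2]
      (u1 *s e1 + u2 *s e2) (v1 *s e1 + v2 *s e2) = R2 \<epsilon> \<beta> u1 u2 v1 v2"
  using rep_matrix_coords[OF assms(1), of 0 "- \<beta>" \<epsilon> 0 0 1 u1 u2 v1 v2] assms(2-)
    tri_swap[of e1 e1 e2]
  by (simp add: R2_def mult_ac)

lemma rep_matrix_R3:
  assumes "ordered_basis scale [e1, e2]" "bin e1 e2 = e2"
    "tri e2 e1 e2 = e2" "tri e1 e2 e1 = e1"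
  shows "rep_matrix scale (regular_representation tri bin) [e1, e2]
      (u1 *s e1 + u2 *s e2) (v1 *s e1 + v2 *s e2) = R3 u1 u2 v1 v2"
  using rep_matrix_coords[OF assms(1), of "- 1" 0 0 1 0 1 u1 u2 v1 v2] assms(2-)
    tri_swap[of e1 e1 e2]
  by (simp add: R3_def mult_ac)

end

theorem theorem5p3:
  fixes scale :: "'k::field_char_0 \<Rightarrow> 'b::ab_group_add \<Rightarrow> 'b"  (infixr "*s" 75)
    and tri :: "'b \<Rightarrow> 'b \<Rightarrow> 'b \<Rightarrow> 'b"
    and bin :: "'b \<Rightarrow> 'b \<Rightarrow> 'b"
  assumes bol: "bol_algebra scale tri bin"
    and dim2: "vector_space.dim scale (UNIV :: 'b set) = 2"
  defines "\<rho> \<equiv> regular_representation tri bin"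
  shows "\<exists>e1 e2. ordered_basis scale [e1, e2] \<and>
    (\<forall>fs. ordered_basis scale fs \<longrightarrow>
       rep_equivalent 2 (rep_matrix scale \<rho> fs) (rep_matrix scale \<rho> [e1, e2])) \<and>
    ((\<exists>\<epsilon>1 \<epsilon>2.
        bin e1 e2 = 0 \<and> tri e2 e1 e2 = \<epsilon>1 *s e1 \<and> tri e1 e2 e1 = \<epsilon>2 *s e2 \<and>
        (\<forall>u1 u2 v1 v2.
           rep_matrix scale \<rho> [e1, e2] (u1 *s e1 + u2 *s e2) (v1 *s e1 + v2 *s e2) =
             R1 \<epsilon>1 \<epsilon>2 u1 u2 v1 v2)) \<or>
     (\<exists>\<epsilon> \<beta>.
        bin e1 e2 = e2 \<and> tri e2 e1 e2 = \<epsilon> *s e1 \<and> tri e1 e2 e1 = \<beta> *s e2 \<and>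
        (\<forall>u1 u2 v1 v2.
           rep_matrix scale \<rho> [e1, e2] (u1 *s e1 + u2 *s e2) (v1 *s e1 + v2 *s e2) =
             R2 \<epsilon> \<beta> u1 u2 v1 v2)) \<or>
     (bin e1 e2 = e2 \<and> tri e2 e1 e2 = e2 \<and> tri e1 e2 e1 = e1 \<and>
        (\<forall>u1 u2 v1 v2.
           rep_matrix scale \<rho> [e1, e2] (u1 *s e1 + u2 *s e2) (v1 *s e1 + v2 *s e2) =
             R3 u1 u2 v1 v2)))"
proof -
  interpret bol_algebra_char_0 scale tri bin
    using bol by (rule bol_algebra_char_0.intro)
  obtain e1 e2 where basis: "ordered_basis scale [e1, e2]" and
    canonical: "(\<exists>\<epsilon>1 \<epsilon>2. bin e1 e2 = 0 \<and> tri e2 e1 e2 = \<epsilon>1 *s e1 \<and> tri e1 e2 e1 = \<epsilon>2 *s e2) \<or>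
     (\<exists>\<epsilon> \<beta>. bin e1 e2 = e2 \<and> tri e2 e1 e2 = \<epsilon> *s e1 \<and> tri e1 e2 e1 = \<beta> *s e2) \<or>
     (bin e1 e2 = e2 \<and> tri e2 e1 e2 = e2 \<and> tri e1 e2 e1 = e1)"
    using canonical_basis[OF dim2] .
  show ?thesis
  proof (rule exI[of _ e1], rule exI[of _ e2], intro conjI allI impI)
    show "ordered_basis scale [e1, e2]" by (rule basis)
  next
    fix fs
    assume fs: "ordered_basis scale fs"
    show "rep_equivalent 2 (rep_matrix scale \<rho> fs) (rep_matrix scale \<rho> [e1, e2])"
      \<comment> \<open>Linearity of \<open>D\<close>, \<open>\<delta>\<close> and
        \<open>\<Delta>\<close> comes from the first ternary, first binary and second ternary
        argument respectively.\<close>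
      using rep_equivalent_ordered_bases[OF basis fs, of "\<lambda>u v x. tri x u v" "\<lambda>u x. bin x u" "\<lambda>u v x. tri u x v"]
        tri_linear_1 tri_linear_2 bin_linear_1 dim2
      unfolding \<rho>_def regular_representation_def by simp
  next
    show "(\<exists>\<epsilon>1 \<epsilon>2.
        bin e1 e2 = 0 \<and> tri e2 e1 e2 = \<epsilon>1 *s e1 \<and> tri e1 e2 e1 = \<epsilon>2 *s e2 \<and>
        (\<forall>u1 u2 v1 v2.
           rep_matrix scale \<rho> [e1, e2] (u1 *s e1 + u2 *s e2) (v1 *s e1 + v2 *s e2) =
             R1 \<epsilon>1 \<epsilon>2 u1 u2 v1 v2)) \<or>
     (\<exists>\<epsilon> \<beta>.
        bin e1 e2 = e2 \<and> tri e2 e1 e2 = \<epsilon> *s e1 \<and> tri e1 e2 e1 = \<beta> *s e2 \<and>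
        (\<forall>u1 u2 v1 v2.
           rep_matrix scale \<rho> [e1, e2] (u1 *s e1 + u2 *s e2) (v1 *s e1 + v2 *s e2) =
             R2 \<epsilon> \<beta> u1 u2 v1 v2)) \<or>
     (bin e1 e2 = e2 \<and> tri e2 e1 e2 = e2 \<and> tri e1 e2 e1 = e1 \<and>
        (\<forall>u1 u2 v1 v2.
           rep_matrix scale \<rho> [e1, e2] (u1 *s e1 + u2 *s e2) (v1 *s e1 + v2 *s e2) =
             R3 u1 u2 v1 v2))"
      using canonical unfolding \<rho>_def
      \<comment> \<open>The structure constants of the canonical basis are carried over unchanged as
        the parameters of the matrix.\<close>
      by (elim disj_forward ex_forward)
        (simp_all add: rep_matrix_R1[OF basis] rep_matrix_R2[OF basis] rep_matrix_R3[OF basis])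
  qed
qed

end
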